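(* Let $M$ be a smooth orientable 3-manifold and let $(\omega^1,\omega^2)$ be a bi-contact structure on $M$ whose contact forms are normalized so that $\omega^1\wedge d\omega^1=-\epsilon\,\omega^2\wedge d\omega^2$ for some constant $\epsilon\in\{+1,-1\}$. Then every bi-contactomorphism $\Phi:M\to M$ is a homothety of the pair of contact forms: there are a nowhere vanishing function $a$ on $M$ and a sign $\delta=\pm1$ (locally constant) such that $\Phi^*\omega^1=a\,\omega^1$ and $\Phi^*\omega^2=\delta a\,\omega^2$.
   Context: A bi-contact structure on an orientable 3-manifold $M$ is a pair of contact distributions $\mathcal{D}_1,\mathcal{D}_2$ with $\mathcal{D}_1(p)\neq\mathcal{D}_2(p)$ for all $p\in M$; all are assumed co-orientable, and one writes $(\omega^1,\omega^2)$ for the structure when $\mathcal{D}_i=\ker\omega^i$. A bi-contactomorphism is a diffeomorphism $\Phi:M\to M$ which is simultaneously a contactomorphism of $\mathcal{D}_1$ and of $\mathcal{D}_2$, i.e. $\Phi_*\mathcal{D}_i=\mathcal{D}_i$ for $i=1,2$. (Any bi-contact structure can be represented by forms normalized as in the claim.) *)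

theory Defs
  imports "HOL-Analysis.Analysis"
begin

subsection \<open>Smooth functions on open subsets of Euclidean spaces\<close>

primrec Ck_on ::
  "nat \<Rightarrow> 'e::euclidean_space set \<Rightarrow> ('e \<Rightarrow> 'f::real_normed_vector) \<Rightarrow> bool" where
  "Ck_on 0 S f \<longleftrightarrow> continuous_on S f"
| "Ck_on (Suc n) S f \<longleftrightarrow>
     (\<forall>x\<in>S. f differentiable (at x)) \<and>
     (\<forall>v. Ck_on n S (\<lambda>x. frechet_derivative f (at x) v))"

(* Meant for open S only: derivatives are taken in the full neighbourhood filter. *)
definition smooth_on ::
  "'e::euclidean_space set \<Rightarrow> ('e \<Rightarrow> 'f::real_normed_vector) \<Rightarrow> bool" where
  "smooth_on S f \<longleftrightarrow> (\<forall>n. Ck_on n S f)"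

subsection \<open>Smooth 3-manifolds\<close>

(* A chart is a domain with a coordinate map; the values of the map off the domain are irrelevant. *)
type_synonym 'a chart = "'a set \<times> ('a \<Rightarrow> real^3)"

abbreviation cdom :: "'a chart \<Rightarrow> 'a set" where
  "cdom c \<equiv> fst c"

abbreviation cmap :: "'a chart \<Rightarrow> 'a \<Rightarrow> real^3" where
  "cmap c \<equiv> snd c"

abbreviation cinv :: "'a chart \<Rightarrow> real^3 \<Rightarrow> 'a" where
  "cinv c \<equiv> inv_into (cdom c) (cmap c)"

abbreviation cimg :: "'a chart \<Rightarrow> (real^3) set" where
  "cimg c \<equiv> cmap c ` cdom c"

definition is_chart :: "'a topology \<Rightarrow> 'a chart \<Rightarrow> bool" where
  "is_chart X c \<longleftrightarrow> openin X (cdom c) \<and> open (cimg c) \<and>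
     homeomorphic_map (subtopology X (cdom c)) (top_of_set (cimg c)) (cmap c)"

definition transition :: "'a chart \<Rightarrow> 'a chart \<Rightarrow> real^3 \<Rightarrow> real^3" where
  "transition c c' = (\<lambda>x. cmap c' (cinv c x))"

definition smooth_atlas :: "'a topology \<Rightarrow> 'a chart set \<Rightarrow> bool" where
  "smooth_atlas X A \<longleftrightarrow>
     (\<forall>c\<in>A. is_chart X c) \<and>
     (\<Union>c\<in>A. cdom c) = topspace X \<and>
     (\<forall>c\<in>A. \<forall>c'\<in>A. smooth_on (cmap c ` (cdom c \<inter> cdom c')) (transition c c'))"

definition smooth_3_manifold :: "'a topology \<Rightarrow> 'a chart set \<Rightarrow> bool" where
  "smooth_3_manifold X A \<longleftrightarrow>
     Hausdorff_space X \<and> second_countable X \<and> smooth_atlas X A"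

(* A need not be maximal, so an oriented atlas is only required to be compatible with it. *)
definition orientable_manifold :: "'a topology \<Rightarrow> 'a chart set \<Rightarrow> bool" where
  "orientable_manifold X A \<longleftrightarrow>
     (\<exists>B. smooth_atlas X B \<and> smooth_atlas X (A \<union> B) \<and>
        (\<forall>c\<in>B. \<forall>c'\<in>B. \<forall>p \<in> cdom c \<inter> cdom c'.
           det (matrix (frechet_derivative (transition c c') (at (cmap c p)))) > 0))"

definition smooth_map ::
  "'a topology \<Rightarrow> 'a chart set \<Rightarrow> 'b topology \<Rightarrow> 'b chart set \<Rightarrow> ('a \<Rightarrow> 'b) \<Rightarrow> bool" where
  "smooth_map X A Y B f \<longleftrightarrow> continuous_map X Y f \<and>
     (\<forall>c\<in>A. \<forall>c'\<in>B. smooth_on (cmap c ` {p \<in> cdom c. f p \<in> cdom c'})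
                               (\<lambda>x. cmap c' (f (cinv c x))))"

definition smooth_function :: "'a chart set \<Rightarrow> ('a \<Rightarrow> real) \<Rightarrow> bool" where
  "smooth_function A f \<longleftrightarrow> (\<forall>c\<in>A. smooth_on (cimg c) (\<lambda>x. f (cinv c x)))"

definition diffeomorphism :: "'a topology \<Rightarrow> 'a chart set \<Rightarrow> ('a \<Rightarrow> 'a) \<Rightarrow> bool" where
  "diffeomorphism X A f \<longleftrightarrow> bij_betw f (topspace X) (topspace X) \<and>
     smooth_map X A X A f \<and> smooth_map X A X A (inv_into (topspace X) f)"

definition locally_constant :: "'a topology \<Rightarrow> ('a \<Rightarrow> 'b) \<Rightarrow> bool" where
  "locally_constant X f \<longleftrightarrow>
     (\<forall>p\<in>topspace X. \<exists>U. openin X U \<and> p \<in> U \<and> (\<forall>q\<in>U. f q = f p))"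

subsection \<open>Tangent vectors and differential forms\<close>

(* A tangent vector at p is the family of its coordinate vectors in the charts around p, which
   transform by the derivatives of the transition maps; the remaining entries are zero. *)
type_synonym 'a tvec = "'a chart \<Rightarrow> real^3"

definition tangent_space :: "'a chart set \<Rightarrow> 'a \<Rightarrow> 'a tvec set" where
  "tangent_space A p =
     {v. (\<forall>c\<in>A. \<forall>c'\<in>A. p \<in> cdom c \<longrightarrow> p \<in> cdom c' \<longrightarrow>
            v c' = frechet_derivative (transition c c') (at (cmap c p)) (v c)) \<and>
         (\<forall>c. \<not> (c \<in> A \<and> p \<in> cdom c) \<longrightarrow> v c = 0)}"

(* The tangent vector at p with coordinate vector e in the chart c. *)
definition coord_vec :: "'a chart set \<Rightarrow> 'a chart \<Rightarrow> 'a \<Rightarrow> real^3 \<Rightarrow> 'a tvec" where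
  "coord_vec A c p e = (\<lambda>c'. if c' \<in> A \<and> p \<in> cdom c'
     then frechet_derivative (transition c c') (at (cmap c p)) e else 0)"

definition chart_at :: "'a chart set \<Rightarrow> 'a \<Rightarrow> 'a chart" where
  "chart_at A p = (SOME c. c \<in> A \<and> p \<in> cdom c)"

(* By the chain rule the result does not depend on the chart chosen around p. *)
definition differential ::
  "'a chart set \<Rightarrow> 'b chart set \<Rightarrow> ('a \<Rightarrow> 'b) \<Rightarrow> 'a \<Rightarrow> 'a tvec \<Rightarrow> 'b tvec" where
  "differential A B f p v = (\<lambda>c'. if c' \<in> B \<and> f p \<in> cdom c'
     then let c = chart_at A p in
          frechet_derivative (\<lambda>x. cmap c' (f (cinv c x))) (at (cmap c p)) (v c)
     else 0)"

type_synonym 'a form1 = "'a \<Rightarrow> 'a tvec \<Rightarrow> real"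
type_synonym 'a form2 = "'a \<Rightarrow> 'a tvec \<Rightarrow> 'a tvec \<Rightarrow> real"
type_synonym 'a form3 = "'a \<Rightarrow> 'a tvec \<Rightarrow> 'a tvec \<Rightarrow> 'a tvec \<Rightarrow> real"

definition form_rep ::
  "'a chart set \<Rightarrow> 'a form1 \<Rightarrow> 'a chart \<Rightarrow> real^3 \<Rightarrow> real^3 \<Rightarrow> real" where
  "form_rep A \<omega> c x e = \<omega> (cinv c x) (coord_vec A c (cinv c x) e)"

(* Only the values of a form on the tangent spaces matter. *)
definition one_form :: "'a topology \<Rightarrow> 'a chart set \<Rightarrow> 'a form1 \<Rightarrow> bool" where
  "one_form X A \<omega> \<longleftrightarrow>
     (\<forall>p\<in>topspace X. \<forall>u\<in>tangent_space A p. \<forall>v\<in>tangent_space A p.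
        \<omega> p (\<lambda>c. u c + v c) = \<omega> p u + \<omega> p v) \<and>
     (\<forall>p\<in>topspace X. \<forall>r. \<forall>v\<in>tangent_space A p.
        \<omega> p (\<lambda>c. r *\<^sub>R v c) = r * \<omega> p v) \<and>
     (\<forall>c\<in>A. \<forall>e. smooth_on (cimg c) (\<lambda>x. form_rep A \<omega> c x e))"

(* The coordinate formula d\<omega>(u,v) = u(\<omega>(v)) - v(\<omega>(u)), with u and v extended by constant
   coordinates; by the symmetry of second derivatives the chart chosen around p is irrelevant. *)
definition ext_deriv :: "'a chart set \<Rightarrow> 'a form1 \<Rightarrow> 'a form2" where
  "ext_deriv A \<omega> p u v = (let c = chart_at A p; x = cmap c p in
     frechet_derivative (\<lambda>y. form_rep A \<omega> c y (v c)) (at x) (u c) -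
     frechet_derivative (\<lambda>y. form_rep A \<omega> c y (u c)) (at x) (v c))"

definition wedge :: "'a form1 \<Rightarrow> 'a form2 \<Rightarrow> 'a form3" where
  "wedge \<alpha> \<beta> p u v w = \<alpha> p u * \<beta> p v w + \<alpha> p v * \<beta> p w u + \<alpha> p w * \<beta> p u v"

definition pullback :: "'a chart set \<Rightarrow> ('a \<Rightarrow> 'a) \<Rightarrow> 'a form1 \<Rightarrow> 'a form1" where
  "pullback A f \<omega> p v = \<omega> (f p) (differential A A f p v)"

subsection \<open>Bi-contact structures\<close>

definition contact_form :: "'a topology \<Rightarrow> 'a chart set \<Rightarrow> 'a form1 \<Rightarrow> bool" where
  "contact_form X A \<omega> \<longleftrightarrow> one_form X A \<omega> \<and>
     (\<forall>p\<in>topspace X. \<exists>u\<in>tangent_space A p. \<exists>v\<in>tangent_space A p. \<exists>w\<in>tangent_space A p.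
        wedge \<omega> (ext_deriv A \<omega>) p u v w \<noteq> 0)"

type_synonym 'a distribution = "'a \<Rightarrow> 'a tvec set"

definition ker_form :: "'a chart set \<Rightarrow> 'a form1 \<Rightarrow> 'a distribution" where
  "ker_form A \<omega> p = {v \<in> tangent_space A p. \<omega> p v = 0}"

(* Co-orientable: the contact form is required globally. *)
definition contact_distribution :: "'a topology \<Rightarrow> 'a chart set \<Rightarrow> 'a distribution \<Rightarrow> bool" where
  "contact_distribution X A D \<longleftrightarrow>
     (\<exists>\<omega>. contact_form X A \<omega> \<and> (\<forall>p\<in>topspace X. D p = ker_form A \<omega> p))"

definition bi_contact_structure ::
  "'a topology \<Rightarrow> 'a chart set \<Rightarrow> 'a distribution \<Rightarrow> 'a distribution \<Rightarrow> bool" where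
  "bi_contact_structure X A D1 D2 \<longleftrightarrow>
     contact_distribution X A D1 \<and> contact_distribution X A D2 \<and>
     (\<forall>p\<in>topspace X. D1 p \<noteq> D2 p)"

definition push_forward ::
  "'a topology \<Rightarrow> 'a chart set \<Rightarrow> ('a \<Rightarrow> 'a) \<Rightarrow> 'a distribution \<Rightarrow> 'a distribution" where
  "push_forward X A f D q =
     (let p = inv_into (topspace X) f q in differential A A f p ` D p)"

definition contactomorphism ::
  "'a topology \<Rightarrow> 'a chart set \<Rightarrow> 'a distribution \<Rightarrow> ('a \<Rightarrow> 'a) \<Rightarrow> bool" where
  "contactomorphism X A D f \<longleftrightarrow> diffeomorphism X A f \<and>
     (\<forall>q\<in>topspace X. push_forward X A f D q = D q)"

definition bi_contactomorphism ::
  "'a topology \<Rightarrow> 'a chart set \<Rightarrow> 'a distribution \<Rightarrow> 'a distribution \<Rightarrow> ('a \<Rightarrow> 'a) \<Rightarrow> bool" where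
  "bi_contactomorphism X A D1 D2 f \<longleftrightarrow>
     contactomorphism X A D1 f \<and> contactomorphism X A D2 f"

end

(* A contactomorphism of ker \<omega> satisfies \<Phi>*\<omega> = a \<omega>; since \<omega> \<and> da \<and> \<omega> = 0, this gives
   \<Phi>*(\<omega> \<and> d\<omega>) = a\<^sup>2 \<omega> \<and> d\<omega>. If \<Phi>*\<omega>1 = a \<omega>1 and \<Phi>*\<omega>2 = b \<omega>2, applying \<Phi>* to the normalization
   yields a\<^sup>2 = b\<^sup>2, so that b / a is a continuous function with values in {1, -1}. *)
theory Submission
  imports Defs
begin

subsection \<open>Smooth functions\<close>

text \<open>The main work behind the overview is naturality of the exterior derivative, up to the
  conformal factor. \<open>ext_deriv\<close> is a formula in one chosen chart with vectors extended
  by constant coordinates, so pulling a form back brings in second derivatives of the coordinate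
  expression of \<Phi>; they disappear after antisymmetrization because second derivatives are
  symmetric. To write da at all, the factor a must be smooth. It is first found pointwise from the
  inclusion of ker \<omega> in ker \<Phi>*\<omega>, and near each point it is then the quotient of
  the values of the two forms on a vector with constant coordinates. That inclusion does not prevent
  a from vanishing. From a^2 = b^2 the two factors vanish together, and at such a point the
  differential would map the whole tangent space into the intersection of the two contact planes at
  the image point. This is where the planes being distinct enters.\<close>

lemma Ck_on_subset: "Ck_on n S f \<Longrightarrow> T \<subseteq> S \<Longrightarrow> Ck_on n T f"
  by (induction n arbitrary: f) (auto intro: continuous_on_subset)

text \<open>On an open set, agreement on \<open>S\<close> is agreement near each of its points, so
  the derivatives agree on \<open>S\<close> as well and the recursion continues.\<close>

lemma Ck_on_cong:
  assumes "open S" "\<And>x. x \<in> S \<Longrightarrow> f x = g x"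
  shows "Ck_on n S f \<longleftrightarrow> Ck_on n S g"
proof -
  have *: "Ck_on n S g" if "Ck_on n S f" "\<And>x. x \<in> S \<Longrightarrow> f x = g x" for f g
    using that
  proof (induction n arbitrary: f g)
    case 0
    then show ?case by (simp cong: continuous_on_cong)
  next
    case (Suc n)
    have D: "(g has_derivative frechet_derivative f (at x)) (at x)" if "x \<in> S" for x
      using Suc.prems that assms(1)
      by (auto intro: has_derivative_transform_within_open simp: frechet_derivative_works)
    have "frechet_derivative f (at x) = frechet_derivative g (at x)" if "x \<in> S" for x
      using frechet_derivative_at[OF D[OF that]] .
    then have "Ck_on n S (\<lambda>x. frechet_derivative g (at x) v)" for v
      using Suc.IH[of "\<lambda>x. frechet_derivative f (at x) v"] Suc.prems by simp
    then show ?case using D by (auto simp: differentiable_def)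
  qed
  show ?thesis using *[of f g] *[of g f] assms(2) by metis
qed

lemma Ck_on_SucD: "Ck_on (Suc n) S f \<Longrightarrow> Ck_on n S f"
  by (induction n arbitrary: f)
    (auto intro!: continuous_at_imp_continuous_on differentiable_imp_continuous_within)

lemma Ck_on_Union:
  assumes "\<And>U. U \<in> C \<Longrightarrow> open U" "\<And>U. U \<in> C \<Longrightarrow> Ck_on n U f"
  shows "Ck_on n (\<Union>C) f"
  using assms(2)
proof (induction n arbitrary: f)
  case 0
  then show ?case using assms(1) by (auto intro: continuous_on_open_Union)
next
  case (Suc n)
  have "Ck_on n (\<Union>C) (\<lambda>x. frechet_derivative f (at x) v)" for v
    by (rule Suc.IH) (drule Suc.prems, simp only: Ck_on.simps)
  moreover have "f differentiable (at x)" if x: "x \<in> \<Union>C" for x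
    using x
  proof
    fix U assume "U \<in> C" "x \<in> U"
    then show ?thesis using Suc.prems[of U] by simp
  qed
  ultimately show ?case by simp
qed

text \<open>Lets any known derivative \<open>f'\<close> stand in for the one selected by
  \<open>frechet_derivative\<close>, so that the inductions below reduce to the usual
  differentiation rules.\<close>

lemma Ck_on_SucI:
  assumes S: "open S" and f': "\<And>x. x \<in> S \<Longrightarrow> (f has_derivative f' x) (at x)"
    and Ck: "\<And>v. Ck_on n S (\<lambda>x. f' x v)"
  shows "Ck_on (Suc n) S f"
proof -
  have "Ck_on n S (\<lambda>x. frechet_derivative f (at x) v)" for v
    by (rule Ck_on_cong[OF S, THEN iffD1, OF _ Ck[of v]]) (simp add: frechet_derivative_at[OF f'])
  moreover have "f differentiable (at x)" if "x \<in> S" for x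
    using f'[OF that] by (rule differentiableI)
  ultimately show ?thesis by simp
qed

lemma Ck_on_has_derivative:
  "Ck_on (Suc n) S f \<Longrightarrow> x \<in> S \<Longrightarrow> (f has_derivative frechet_derivative f (at x)) (at x)"
  by (simp add: frechet_derivative_works)

lemma Ck_on_const: "Ck_on n S (\<lambda>x. c)"
  by (induction n arbitrary: c) auto

lemma Ck_on_add:
  assumes "open S" "Ck_on n S f" "Ck_on n S g"
  shows "Ck_on n S (\<lambda>x. f x + g x)"
  using assms(2,3)
proof (induction n arbitrary: f g)
  case 0
  then show ?case by (simp add: continuous_on_add)
next
  case (Suc n)
  show ?case
  proof (rule Ck_on_SucI[OF assms(1)])
    show "((\<lambda>x. f x + g x) has_derivative
        (\<lambda>v. frechet_derivative f (at x) v + frechet_derivative g (at x) v)) (at x)" if "x \<in> S" for x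
      using has_derivative_add[OF Suc.prems[THEN Ck_on_has_derivative, OF that]] .
    show "Ck_on n S (\<lambda>x. frechet_derivative f (at x) v + frechet_derivative g (at x) v)" for v
      using Suc.prems by (intro Suc.IH) simp_all
  qed
qed

lemma Ck_on_sum:
  assumes "open S" "\<And>i. i \<in> I \<Longrightarrow> Ck_on n S (f i)"
  shows "Ck_on n S (\<lambda>x. \<Sum>i\<in>I. f i x)"
  using assms(2)
  by (induction I rule: infinite_finite_induct)
    (auto intro: Ck_on_const Ck_on_add[OF assms(1)])

lemma Ck_on_scaleR:
  fixes f :: "'e::euclidean_space \<Rightarrow> real"
  assumes "open S" "Ck_on n S f" "Ck_on n S g"
  shows "Ck_on n S (\<lambda>x. f x *\<^sub>R g x)"
  using assms(2,3)
proof (induction n arbitrary: f g)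
  case 0
  then show ?case by (simp add: continuous_on_scaleR)
next
  case (Suc n)
  show ?case
  proof (rule Ck_on_SucI[OF assms(1)])
    show "((\<lambda>x. f x *\<^sub>R g x) has_derivative
        (\<lambda>v. f x *\<^sub>R frechet_derivative g (at x) v + frechet_derivative f (at x) v *\<^sub>R g x)) (at x)"
      if "x \<in> S" for x
      using has_derivative_scaleR[OF Suc.prems[THEN Ck_on_has_derivative, OF that]] .
    show "Ck_on n S (\<lambda>x. f x *\<^sub>R frechet_derivative g (at x) v + frechet_derivative f (at x) v *\<^sub>R g x)"
      for v
      using Suc.prems Suc.prems[THEN Ck_on_SucD] by (intro Ck_on_add[OF assms(1)] Suc.IH) simp_all
  qed
qed

text \<open>The derivative of 1/f is a product of f' and two copies of 1/f itself, so the induction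
  hypothesis for the same \<open>f\<close> already controls every factor.\<close>

lemma Ck_on_inverse:
  fixes f :: "'e::euclidean_space \<Rightarrow> real"
  assumes "open S" "\<And>x. x \<in> S \<Longrightarrow> f x \<noteq> 0" "Ck_on n S f"
  shows "Ck_on n S (\<lambda>x. inverse (f x))"
  using assms(3)
proof (induction n)
  case 0
  then show ?case using assms(2) by (simp add: continuous_on_inverse)
next
  case (Suc n)
  have inv: "Ck_on n S (\<lambda>x. inverse (f x))"
    using Suc Ck_on_SucD by blast
  show ?case
  proof (rule Ck_on_SucI[OF assms(1)])
    show "((\<lambda>x. inverse (f x)) has_derivative
        (\<lambda>v. - (inverse (f x) * frechet_derivative f (at x) v * inverse (f x)))) (at x)"
      if "x \<in> S" for x
      using Deriv.has_derivative_inverse[OF assms(2)[OF that] Ck_on_has_derivative[OF Suc.prems that]] .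
    have "Ck_on n S (\<lambda>x. (- 1) *\<^sub>R (inverse (f x) *\<^sub>R frechet_derivative f (at x) v *\<^sub>R inverse (f x)))"
      for v
      using Suc.prems inv by (intro Ck_on_scaleR[OF assms(1)] Ck_on_const) simp_all
    then show "Ck_on n S (\<lambda>x. - (inverse (f x) * frechet_derivative f (at x) v * inverse (f x)))" for v
      by (simp add: mult.assoc)
  qed
qed

lemma Ck_on_bounded_linear:
  assumes "bounded_linear L" "open S" "Ck_on n S f"
  shows "Ck_on n S (\<lambda>x. L (f x))"
  using assms(3)
proof (induction n arbitrary: f)
  case 0
  then show ?case by (auto intro: bounded_linear.continuous_on[OF assms(1)])
next
  case (Suc n)
  show ?case
  proof (rule Ck_on_SucI[OF assms(2)])
    show "((\<lambda>x. L (f x)) has_derivative (\<lambda>v. L (frechet_derivative f (at x) v))) (at x)"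
      if "x \<in> S" for x
      using bounded_linear.has_derivative[OF assms(1) Ck_on_has_derivative[OF Suc.prems that]] .
    show "Ck_on n S (\<lambda>x. L (frechet_derivative f (at x) v))" for v
      using Suc.prems by (intro Suc.IH) simp
  qed
qed

text \<open>\<open>Ck_on\<close> controls derivatives in fixed directions only. This expansion
  trades a direction that moves with the base point for fixed basis directions with moving
  coefficients.\<close>

lemma linear_expand_Basis:
  fixes L :: "'e::euclidean_space \<Rightarrow> 'f::real_vector"
  assumes "linear L"
  shows "L v = (\<Sum>b\<in>Basis. (v \<bullet> b) *\<^sub>R L b)"
proof -
  have "L v = L (\<Sum>b\<in>Basis. (v \<bullet> b) *\<^sub>R b)" by (simp only: euclidean_representation)
  also have "\<dots> = (\<Sum>b\<in>Basis. (v \<bullet> b) *\<^sub>R L b)"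
    by (simp add: linear_sum[OF assms] linear_scale[OF assms])
  finally show ?thesis .
qed

text \<open>In the chain rule f'(g x)(g'(x) v) the direction g'(x) v depends on x. Expanded along
  the basis, it becomes a sum of products of components of g'(x) v with the compositions f'(g x) b,
  to which the induction hypothesis applies.\<close>

lemma Ck_on_compose:
  fixes f :: "'f::euclidean_space \<Rightarrow> 'g::real_normed_vector"
  assumes "open S" "g ` S \<subseteq> T" "Ck_on n S g" "Ck_on n T f"
  shows "Ck_on n S (\<lambda>x. f (g x))"
  using assms(3,4)
proof (induction n arbitrary: f)
  case 0
  then show ?case using assms(2) by (auto intro: continuous_on_compose2)
next
  case (Suc n)
  let ?f' = "\<lambda>x. frechet_derivative f (at (g x))" and ?g' = "\<lambda>x. frechet_derivative g (at x)"
  have f: "(f has_derivative ?f' x) (at (g x))" if "x \<in> S" for x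
    using Suc.prems(2) that assms(2) by (auto simp: frechet_derivative_works)
  have g: "(g has_derivative ?g' x) (at x)" if "x \<in> S" for x
    using Suc.prems(1) that by (auto simp: frechet_derivative_works)
  have f': "?f' x (?g' x v) = (\<Sum>b\<in>Basis. (?g' x v \<bullet> b) *\<^sub>R ?f' x b)" if "x \<in> S" for x v
    by (rule linear_expand_Basis[OF has_derivative_linear[OF f[OF that]]])
  have "Ck_on n S (\<lambda>x. \<Sum>b\<in>Basis. (?g' x v \<bullet> b) *\<^sub>R ?f' x b)" for v
    using Suc.prems Ck_on_SucD[OF Suc.prems(1)]
    by (intro Ck_on_sum[OF assms(1)] Ck_on_scaleR[OF assms(1)] Suc.IH
        Ck_on_bounded_linear[OF bounded_linear_inner_left assms(1)]) auto
  then have "Ck_on n S (\<lambda>x. ?f' x (?g' x v))" for v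
    using Ck_on_cong[OF assms(1), of "\<lambda>x. ?f' x (?g' x v)"] f' by simp
  then show ?case
    using has_derivative_compose[OF g f] by (intro Ck_on_SucI[OF assms(1)]) auto
qed

section \<open>Smoothness of all orders on open sets\<close>

lemma smooth_on_has_derivative:
  "smooth_on S f \<Longrightarrow> x \<in> S \<Longrightarrow> (f has_derivative frechet_derivative f (at x)) (at x)"
  unfolding smooth_on_def using Ck_on_has_derivative by blast

lemma smooth_on_deriv: "smooth_on S f \<Longrightarrow> smooth_on S (\<lambda>x. frechet_derivative f (at x) v)"
  unfolding smooth_on_def by (metis Ck_on.simps(2))

lemma smooth_on_imp_continuous_on: "smooth_on S f \<Longrightarrow> continuous_on S f"
  unfolding smooth_on_def by (metis Ck_on.simps(1))

lemma smooth_on_subset: "smooth_on S f \<Longrightarrow> T \<subseteq> S \<Longrightarrow> smooth_on T f"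
  unfolding smooth_on_def using Ck_on_subset by blast

lemma smooth_on_cong:
  "open S \<Longrightarrow> (\<And>x. x \<in> S \<Longrightarrow> f x = g x) \<Longrightarrow> smooth_on S f \<longleftrightarrow> smooth_on S g"
  unfolding smooth_on_def using Ck_on_cong by blast

lemma smooth_on_locally:
  assumes "\<And>x. x \<in> S \<Longrightarrow> \<exists>U. open U \<and> x \<in> U \<and> smooth_on U f"
  shows "smooth_on S f"
proof -
  let ?C = "{U. open U \<and> smooth_on U f}"
  have "Ck_on n (\<Union>?C) f" for n
    by (rule Ck_on_Union) (auto simp: smooth_on_def)
  moreover have "S \<subseteq> \<Union>?C" using assms by auto
  ultimately show ?thesis unfolding smooth_on_def by (meson Ck_on_subset)
qed

lemma smooth_on_has_derivative_deriv:
  "smooth_on S f \<Longrightarrow> x \<in> S \<Longrightarrow>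
    ((\<lambda>y. frechet_derivative f (at y) v) has_derivative
      frechet_derivative (\<lambda>y. frechet_derivative f (at y) v) (at x)) (at x)"
  by (rule smooth_on_has_derivative[OF smooth_on_deriv])

lemma smooth_on_bounded_linear:
  "bounded_linear L \<Longrightarrow> open S \<Longrightarrow> smooth_on S f \<Longrightarrow> smooth_on S (\<lambda>x. L (f x))"
  by (simp add: smooth_on_def Ck_on_bounded_linear)

lemma smooth_on_compose:
  fixes f :: "'f::euclidean_space \<Rightarrow> 'g::real_normed_vector"
  shows "open S \<Longrightarrow> g ` S \<subseteq> T \<Longrightarrow> smooth_on S g \<Longrightarrow> smooth_on T f \<Longrightarrow> smooth_on S (\<lambda>x. f (g x))"
  unfolding smooth_on_def using Ck_on_compose by blast

lemma smooth_on_sum: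
  "open S \<Longrightarrow> (\<And>i. i \<in> I \<Longrightarrow> smooth_on S (f i)) \<Longrightarrow> smooth_on S (\<lambda>x. \<Sum>i\<in>I. f i x)"
  by (simp add: smooth_on_def Ck_on_sum)

lemma smooth_on_mult:
  fixes f g :: "'e::euclidean_space \<Rightarrow> real"
  shows "open S \<Longrightarrow> smooth_on S f \<Longrightarrow> smooth_on S g \<Longrightarrow> smooth_on S (\<lambda>x. f x * g x)"
  using Ck_on_scaleR[of S _ f g] by (simp add: smooth_on_def)

lemma smooth_on_divide:
  fixes f g :: "'e::euclidean_space \<Rightarrow> real"
  assumes "open S" "smooth_on S f" "smooth_on S g" "\<And>x. x \<in> S \<Longrightarrow> g x \<noteq> 0"
  shows "smooth_on S (\<lambda>x. f x / g x)"
  unfolding divide_inverse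
  by (intro smooth_on_mult) (use assms in \<open>auto simp: smooth_on_def intro: Ck_on_inverse\<close>)

subsection \<open>Second derivatives and pullbacks in coordinates\<close>

text \<open>The second difference of \<open>f\<close> over the parallelogram with sides h u and h v
  is symmetric in u and v. Two applications of the mean value theorem, in either order, equate it
  with h^2 times each mixed derivative at a nearby point; continuity of these derivatives then
  forces equality at \<open>x\<close>.\<close>

lemma symmetric_second_derivative_real:
  fixes f :: "'e::euclidean_space \<Rightarrow> real"
  assumes "open S" "x \<in> S" "smooth_on S f"
  shows "frechet_derivative (\<lambda>y. frechet_derivative f (at y) u) (at x) v =
         frechet_derivative (\<lambda>y. frechet_derivative f (at y) v) (at x) u"
proof -
  define D where "D u y = frechet_derivative f (at y) u" for u y
  define H where "H u v y = frechet_derivative (D u) (at y) v" for u v y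
  have smD: "smooth_on S (D u)" for u
    unfolding D_def by (rule smooth_on_deriv[OF assms(3)])
  have smH: "smooth_on S (H u v)" for u v
    unfolding H_def by (rule smooth_on_deriv[OF smD])
  have line: "((\<lambda>s. g (y + s *\<^sub>R u)) has_real_derivative
      frechet_derivative g (at (y + s *\<^sub>R u)) u) (at s)"
    if "y + s *\<^sub>R u \<in> S" "smooth_on S g" for y u s and g :: "'e \<Rightarrow> real"
  proof -
    have g: "(g has_derivative frechet_derivative g (at (y + s *\<^sub>R u))) (at (y + s *\<^sub>R u))"
      using that smooth_on_has_derivative by blast
    have "((\<lambda>s. y + s *\<^sub>R u) has_derivative (\<lambda>h. h *\<^sub>R u)) (at s)"
      by (auto intro!: derivative_eq_intros)
    from has_derivative_compose[of "\<lambda>s. y + s *\<^sub>R u", OF this g]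
    show ?thesis
      by (simp add: has_field_derivative_def linear_scale[OF has_derivative_linear[OF g]]
          mult.commute[of _ "frechet_derivative g (at (y + s *\<^sub>R u)) u"])
  qed
  note derf = line[OF _ assms(3), folded D_def] and derD = line[OF _ smD, folded H_def]
  have key: "\<exists>s t. 0 < s \<and> s < h \<and> 0 < t \<and> t < h \<and>
      f (x + h *\<^sub>R u + h *\<^sub>R v) - f (x + h *\<^sub>R u) - f (x + h *\<^sub>R v) + f x
        = h * h * H u v (x + s *\<^sub>R u + t *\<^sub>R v)"
    if h: "0 < h" and S: "\<And>s t. 0 \<le> s \<Longrightarrow> s \<le> h \<Longrightarrow> 0 \<le> t \<Longrightarrow> t \<le> h \<Longrightarrow> x + s *\<^sub>R u + t *\<^sub>R v \<in> S"
    for h u v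
  proof -
    \<comment> \<open>The second difference is the increment of this function over [0, h]. Its
      derivative is an increment of \<open>D u\<close> along v, so the mean value theorem applies a
      second time.\<close>
    let ?\<phi> = "\<lambda>s. f (x + h *\<^sub>R v + s *\<^sub>R u) - f (x + s *\<^sub>R u)"
    have "\<exists>s. 0 < s \<and> s < h \<and> ?\<phi> h - ?\<phi> 0 = (h - 0) * (D u (x + h *\<^sub>R v + s *\<^sub>R u) - D u (x + s *\<^sub>R u))"
    proof (rule MVT2[OF h])
      fix s assume s: "0 \<le> s" "s \<le> h"
      show "(?\<phi> has_real_derivative D u (x + h *\<^sub>R v + s *\<^sub>R u) - D u (x + s *\<^sub>R u)) (at s)"
        using S[OF s, of h] S[OF s, of 0] h
        by (intro DERIV_diff derf) (auto simp: algebra_simps)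
    qed
    then obtain s where s: "0 < s" "s < h"
      and 1: "?\<phi> h - ?\<phi> 0 = (h - 0) * (D u (x + h *\<^sub>R v + s *\<^sub>R u) - D u (x + s *\<^sub>R u))"
      by blast
    let ?\<psi> = "\<lambda>t. D u (x + s *\<^sub>R u + t *\<^sub>R v)"
    have "\<exists>t. 0 < t \<and> t < h \<and> ?\<psi> h - ?\<psi> 0 = (h - 0) * H u v (x + s *\<^sub>R u + t *\<^sub>R v)"
      by (rule MVT2[OF h derD]) (use S s in auto)
    then obtain t where t: "0 < t" "t < h" "?\<psi> h - ?\<psi> 0 = h * H u v (x + s *\<^sub>R u + t *\<^sub>R v)"
      by auto
    have "f (x + h *\<^sub>R u + h *\<^sub>R v) - f (x + h *\<^sub>R u) - f (x + h *\<^sub>R v) + f x = h * (?\<psi> h - ?\<psi> 0)"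
      using 1 by (simp add: algebra_simps)
    with s t show ?thesis by (metis mult.assoc)
  qed
  have "H u v x = H v u x"
  proof (rule ccontr)
    assume ne: "H u v x \<noteq> H v u x"
    \<comment> \<open>Half the supposed gap: a common value of the two mixed derivatives at nearby
      points cannot be closer than \<open>e\<close> to both values at \<open>x\<close>.\<close>
    define e where "e = dist (H u v x) (H v u x) / 2"
    have e: "e > 0" using ne by (simp add: e_def)
    have "isCont (H u v) x" "isCont (H v u) x"
      using smH smooth_on_imp_continuous_on assms(1,2) continuous_on_eq_continuous_at by blast+
    then obtain d1 d2 where d1: "d1 > 0" "\<And>y. dist y x < d1 \<Longrightarrow> dist (H u v y) (H u v x) < e"
      and d2: "d2 > 0" "\<And>y. dist y x < d2 \<Longrightarrow> dist (H v u y) (H v u x) < e"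
      using e unfolding continuous_at by (metis (no_types, lifting) continuous_at_eps_delta \<open>isCont (H u v) x\<close> \<open>isCont (H v u) x\<close>)
    obtain d3 where d3: "d3 > 0" "ball x d3 \<subseteq> S" using assms(1,2) openE by blast
    define d where "d = min d1 (min d2 d3)"
    \<comment> \<open>With this choice the parallelogram stays within d/2 of \<open>x\<close>; the
      summand 1 keeps the denominator positive when u = v = 0.\<close>
    define h where "h = d / (2 * (norm u + norm v + 1))"
    have n: "norm u + norm v + 1 > 0" by (smt (verit) norm_ge_zero)
    have d: "d > 0" using d1(1) d2(1) d3(1) by (simp add: d_def)
    have h: "h > 0" using n d by (simp add: h_def)
    have near: "dist (x + s *\<^sub>R u + t *\<^sub>R v) x < d" if "0 \<le> s" "s \<le> h" "0 \<le> t" "t \<le> h" for s t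
    proof -
      have "norm (s *\<^sub>R u + t *\<^sub>R v) \<le> s * norm u + t * norm v"
        using that norm_triangle_ineq[of "s *\<^sub>R u" "t *\<^sub>R v"] by simp
      also have "\<dots> \<le> h * norm u + h * norm v"
        using that by (intro add_mono mult_right_mono) auto
      also have "\<dots> \<le> h * (norm u + norm v + 1)" using h by (simp add: algebra_simps)
      also have "\<dots> = d / 2" using n by (simp add: h_def field_simps)
      also have "\<dots> < d" using d by simp
      finally show ?thesis by (simp add: dist_norm add.assoc)
    qed
    have near': "dist (x + s *\<^sub>R v + t *\<^sub>R u) x < d" if "0 \<le> s" "s \<le> h" "0 \<le> t" "t \<le> h" for s t
      using near[of t s] that by (simp add: algebra_simps)
    have inS: "y \<in> S" if "dist y x < d" for y
      using that d3 by (auto simp: d_def dist_commute subset_iff)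
    obtain s t where st: "0 < s" "s < h" "0 < t" "t < h"
      "f (x + h *\<^sub>R u + h *\<^sub>R v) - f (x + h *\<^sub>R u) - f (x + h *\<^sub>R v) + f x
        = h * h * H u v (x + s *\<^sub>R u + t *\<^sub>R v)"
      using key[OF h, of u v] near inS by blast
    obtain s' t' where st': "0 < s'" "s' < h" "0 < t'" "t' < h"
      "f (x + h *\<^sub>R v + h *\<^sub>R u) - f (x + h *\<^sub>R v) - f (x + h *\<^sub>R u) + f x
        = h * h * H v u (x + s' *\<^sub>R v + t' *\<^sub>R u)"
      using key[OF h, of v u] near' inS by blast
    have "h * h * H u v (x + s *\<^sub>R u + t *\<^sub>R v) = h * h * H v u (x + s' *\<^sub>R v + t' *\<^sub>R u)"
      using st(5) st'(5) by (simp add: algebra_simps)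
    then have "H u v (x + s *\<^sub>R u + t *\<^sub>R v) = H v u (x + s' *\<^sub>R v + t' *\<^sub>R u)"
      using h by simp
    moreover have "dist (H u v (x + s *\<^sub>R u + t *\<^sub>R v)) (H u v x) < e"
      using near[of s t] st by (intro d1) (auto simp: d_def)
    moreover have "dist (H v u (x + s' *\<^sub>R v + t' *\<^sub>R u)) (H v u x) < e"
      using near'[of s' t'] st' by (intro d2) (auto simp: d_def)
    ultimately show False
      unfolding e_def by (smt (verit) dist_real_def field_sum_of_halves)
  qed
  then show ?thesis by (simp add: H_def D_def[abs_def])
qed

text \<open>Taking the inner product with a basis vector commutes with both differentiations, which
  reduces the claim to real components.\<close>

lemma symmetric_second_derivative:
  fixes f :: "'e::euclidean_space \<Rightarrow> 'f::euclidean_space"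
  assumes "open S" "x \<in> S" "smooth_on S f"
  shows "frechet_derivative (\<lambda>y. frechet_derivative f (at y) u) (at x) v =
         frechet_derivative (\<lambda>y. frechet_derivative f (at y) v) (at x) u"
proof (rule euclidean_eqI)
  fix b :: 'f assume "b \<in> Basis"
  have 1: "frechet_derivative (\<lambda>y. f y \<bullet> b) (at y) w = frechet_derivative f (at y) w \<bullet> b"
    if "y \<in> S" for y w
    by (rule fun_cong[OF frechet_derivative_at[symmetric]])
      (rule has_derivative_inner_left[OF smooth_on_has_derivative[OF assms(3) that]])
  have 2: "frechet_derivative (\<lambda>y. frechet_derivative (\<lambda>y. f y \<bullet> b) (at y) w) (at x) z =
      frechet_derivative (\<lambda>y. frechet_derivative f (at y) w) (at x) z \<bullet> b" for w z
  proof (rule fun_cong[OF frechet_derivative_at[symmetric]])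
    have "((\<lambda>y. frechet_derivative f (at y) w \<bullet> b) has_derivative
        (\<lambda>z. frechet_derivative (\<lambda>y. frechet_derivative f (at y) w) (at x) z \<bullet> b)) (at x)"
      by (rule has_derivative_inner_left[OF smooth_on_has_derivative_deriv[OF assms(3,2)]])
    then show "((\<lambda>y. frechet_derivative (\<lambda>y. f y \<bullet> b) (at y) w) has_derivative
        (\<lambda>z. frechet_derivative (\<lambda>y. frechet_derivative f (at y) w) (at x) z \<bullet> b)) (at x)"
      by (rule has_derivative_transform_within_open[OF _ assms(1,2)]) (simp add: 1)
  qed
  have "smooth_on S (\<lambda>y. f y \<bullet> b)"
    by (rule smooth_on_bounded_linear[OF bounded_linear_inner_left assms(1,3)])
  from symmetric_second_derivative_real[OF assms(1,2) this, of u v]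
  show "frechet_derivative (\<lambda>y. frechet_derivative f (at y) u) (at x) v \<bullet> b =
      frechet_derivative (\<lambda>y. frechet_derivative f (at y) v) (at x) u \<bullet> b"
    by (simp only: 2)
qed

text \<open>Both the base point F y and the argument F'(y) v move. The first summand differentiates
  the coefficients of \<beta>, the second is \<beta> applied to the second derivative of F; being
  symmetric in u and v, it is the part that antisymmetrization removes.\<close>

lemma has_derivative_pullback_form:
  fixes F :: "'e::euclidean_space \<Rightarrow> 'f::euclidean_space" and \<beta> :: "'f \<Rightarrow> 'f \<Rightarrow> real"
  assumes W: "open W" "x \<in> W" and F: "smooth_on W F" and V: "open V" "F ` W \<subseteq> V"
    and lin: "\<And>y. y \<in> V \<Longrightarrow> linear (\<beta> y)" and \<beta>: "\<And>e. smooth_on V (\<lambda>y. \<beta> y e)"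
  shows "((\<lambda>y. \<beta> (F y) (frechet_derivative F (at y) v)) has_derivative
    (\<lambda>u. frechet_derivative (\<lambda>z. \<beta> z (frechet_derivative F (at x) v)) (at (F x))
           (frechet_derivative F (at x) u) +
         \<beta> (F x) (frechet_derivative (\<lambda>y. frechet_derivative F (at y) v) (at x) u))) (at x)"
proof -
  let ?D = "\<lambda>b. frechet_derivative (\<lambda>z. \<beta> z b) (at (F x))"
  let ?F' = "frechet_derivative F (at x)"
  let ?H = "frechet_derivative (\<lambda>y. frechet_derivative F (at y) v) (at x)"
  have FV: "F y \<in> V" if "y \<in> W" for y using V(2) that by auto
  have expand: "\<beta> y w = (\<Sum>b\<in>Basis. (w \<bullet> b) * \<beta> y b)" if "y \<in> V" for y w
    using linear_expand_Basis[OF lin[OF that], of w] by simp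
  have D: "((\<lambda>z. \<beta> z b) has_derivative ?D b) (at (F x))" for b
    by (rule smooth_on_has_derivative[OF \<beta> FV[OF W(2)]])
  \<comment> \<open>Linearity of \<beta> in its vector argument passes to its derivative in the base
    point, which allows the basis expansion to be recombined after differentiating.\<close>
  have Dsum: "?D w u = (\<Sum>b\<in>Basis. (w \<bullet> b) * ?D b u)" for w u
  proof (rule fun_cong[OF frechet_derivative_at[symmetric]])
    have "((\<lambda>z. \<Sum>b\<in>Basis. (w \<bullet> b) * \<beta> z b) has_derivative (\<lambda>u. \<Sum>b\<in>Basis. (w \<bullet> b) * ?D b u)) (at (F x))"
      by (intro has_derivative_sum has_derivative_mult_right D)
    then show "((\<lambda>z. \<beta> z w) has_derivative (\<lambda>u. \<Sum>b\<in>Basis. (w \<bullet> b) * ?D b u)) (at (F x))"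
      by (rule has_derivative_transform_within_open[OF _ V(1) FV[OF W(2)]]) (simp add: expand[of _ w])
  qed
  have "((\<lambda>y. \<Sum>b\<in>Basis. (frechet_derivative F (at y) v \<bullet> b) * \<beta> (F y) b) has_derivative
     (\<lambda>u. \<Sum>b\<in>Basis. (?F' v \<bullet> b) * ?D b (?F' u) + (?H u \<bullet> b) * \<beta> (F x) b)) (at x)"
    by (intro has_derivative_sum has_derivative_mult has_derivative_inner_left
        smooth_on_has_derivative_deriv[OF F W(2)]
        has_derivative_compose[OF smooth_on_has_derivative[OF F W(2)] D])
  then have "((\<lambda>y. \<Sum>b\<in>Basis. (frechet_derivative F (at y) v \<bullet> b) * \<beta> (F y) b) has_derivative
     (\<lambda>u. ?D (?F' v) (?F' u) + \<beta> (F x) (?H u))) (at x)"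
    by (simp add: Dsum[of "?F' v"] expand[OF FV[OF W(2)], of "?H _"] sum.distrib)
  then show ?thesis
    by (rule has_derivative_transform_within_open[OF _ W])
      (simp add: expand[OF FV, of _ "frechet_derivative F (at _) v"])
qed

text \<open>In coordinates this is F*(d\<beta>) = d(a \<alpha>) = a d\<alpha> + da \<and> \<alpha>,
  evaluated on (u, v), for F*\<beta> = a \<alpha>. Differentiating that relation along u and along v
  and subtracting cancels the second derivatives of F by symmetry.\<close>

lemma ext_deriv_conformal_pullback:
  fixes F :: "'e::euclidean_space \<Rightarrow> 'f::euclidean_space" and \<beta> :: "'f \<Rightarrow> 'f \<Rightarrow> real"
    and \<alpha> :: "'e \<Rightarrow> 'e \<Rightarrow> real" and a :: "'e \<Rightarrow> real"
  assumes W: "open W" "x \<in> W" and F: "smooth_on W F" and V: "open V" "F ` W \<subseteq> V"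
    and lin: "\<And>y. y \<in> V \<Longrightarrow> linear (\<beta> y)" and \<beta>: "\<And>e. smooth_on V (\<lambda>y. \<beta> y e)"
    and \<alpha>: "\<And>e. ((\<lambda>y. \<alpha> y e) has_derivative \<alpha>' e) (at x)"
    and a: "(a has_derivative a') (at x)"
    and eq: "\<And>y e. y \<in> W \<Longrightarrow> \<beta> (F y) (frechet_derivative F (at y) e) = a y * \<alpha> y e"
  shows "frechet_derivative (\<lambda>z. \<beta> z (frechet_derivative F (at x) v)) (at (F x)) (frechet_derivative F (at x) u) -
      frechet_derivative (\<lambda>z. \<beta> z (frechet_derivative F (at x) u)) (at (F x)) (frechet_derivative F (at x) v) =
      a x * (\<alpha>' v u - \<alpha>' u v) + (a' u * \<alpha> x v - a' v * \<alpha> x u)"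
proof -
  let ?F' = "frechet_derivative F (at x)"
  have "frechet_derivative (\<lambda>z. \<beta> z (?F' v)) (at (F x)) (?F' u) +
      \<beta> (F x) (frechet_derivative (\<lambda>y. frechet_derivative F (at y) v) (at x) u)
      = a x * \<alpha>' v u + a' u * \<alpha> x v" for u v
  proof -
    have "((\<lambda>y. a y * \<alpha> y v) has_derivative (\<lambda>u. a x * \<alpha>' v u + a' u * \<alpha> x v)) (at x)"
      by (rule has_derivative_mult[OF a \<alpha>])
    then have "((\<lambda>y. \<beta> (F y) (frechet_derivative F (at y) v)) has_derivative
        (\<lambda>u. a x * \<alpha>' v u + a' u * \<alpha> x v)) (at x)"
      by (rule has_derivative_transform_within_open[OF _ W]) (simp add: eq)
    from fun_cong[OF has_derivative_unique[OF has_derivative_pullback_form[OF W F V lin \<beta>] this], of u]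
    show ?thesis .
  qed
  from this[of v u] this[of u v] symmetric_second_derivative[OF W F, of u v]
  show ?thesis by (simp add: algebra_simps)
qed

lemma smooth_on_pullback_form:
  fixes F :: "'e::euclidean_space \<Rightarrow> 'f::euclidean_space" and \<beta> :: "'f \<Rightarrow> 'f \<Rightarrow> real"
  assumes W: "open W" and F: "smooth_on W F" and V: "F ` W \<subseteq> V"
    and lin: "\<And>y. y \<in> V \<Longrightarrow> linear (\<beta> y)" and \<beta>: "\<And>e. smooth_on V (\<lambda>y. \<beta> y e)"
  shows "smooth_on W (\<lambda>x. \<beta> (F x) (frechet_derivative F (at x) e))"
proof -
  have "\<beta> (F x) (frechet_derivative F (at x) e) =
      (\<Sum>b\<in>Basis. (frechet_derivative F (at x) e \<bullet> b) * \<beta> (F x) b)" if "x \<in> W" for x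
    using linear_expand_Basis[OF lin, of "F x" "frechet_derivative F (at x) e"] V that by auto
  moreover have "smooth_on W (\<lambda>x. \<Sum>b\<in>Basis. (frechet_derivative F (at x) e \<bullet> b) * \<beta> (F x) b)"
    by (intro smooth_on_sum[OF W] smooth_on_mult[OF W] smooth_on_compose[OF W V F \<beta>]
        smooth_on_bounded_linear[OF bounded_linear_inner_left W] smooth_on_deriv[OF F])
  ultimately show ?thesis by (simp cong: smooth_on_cong[OF W])
qed

subsection \<open>Charts and tangent vectors\<close>

lemma topspace_chart: "is_chart X c \<Longrightarrow> topspace (subtopology X (cdom c)) = cdom c"
  unfolding is_chart_def by (simp add: openin_subset Int_absorb1)

lemma cinv_cmap: "is_chart X c \<Longrightarrow> p \<in> cdom c \<Longrightarrow> cinv c (cmap c p) = p"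
  using topspace_chart[of X c] unfolding is_chart_def homeomorphic_eq_everything_map
  by (simp add: inv_into_f_f)

lemma open_cmap_image:
  assumes "is_chart X c" "openin X U"
  shows "open (cmap c ` (cdom c \<inter> U))"
proof -
  have "open_map (subtopology X (cdom c)) (top_of_set (cimg c)) (cmap c)"
    using assms(1) by (simp add: is_chart_def homeomorphic_imp_open_map)
  then have "openin (top_of_set (cimg c)) (cmap c ` (cdom c \<inter> U))"
    using openin_subtopology_Int2[OF assms(2), of "cdom c"] by (simp add: open_map_def)
  then show ?thesis using assms(1) by (simp add: is_chart_def openin_open_eq)
qed

lemma openin_cmap_vimage:
  assumes "is_chart X c" "open T"
  shows "openin X {p \<in> cdom c. cmap c p \<in> T}"
proof -
  have "continuous_map (subtopology X (cdom c)) euclidean (cmap c)"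
    using assms(1) unfolding is_chart_def
    by (blast intro: continuous_map_into_fulltopology homeomorphic_imp_continuous_map)
  from openin_continuous_map_preimage[OF this, of T]
  have "openin (subtopology X (cdom c)) {p \<in> cdom c. cmap c p \<in> T}"
    using assms(2) by (simp only: topspace_chart[OF assms(1)] open_openin)
  then show ?thesis
    using assms(1) by (simp add: is_chart_def openin_open_subtopology)
qed

lemma smooth_atlas_chart: "smooth_atlas X A \<Longrightarrow> c \<in> A \<Longrightarrow> is_chart X c"
  by (simp add: smooth_atlas_def)

lemma smooth_atlas_topspace:
  "smooth_atlas X A \<Longrightarrow> c \<in> A \<Longrightarrow> p \<in> cdom c \<Longrightarrow> p \<in> topspace X"
  unfolding smooth_atlas_def by blast

lemma chart_at:
  assumes "smooth_atlas X A" "p \<in> topspace X"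
  shows "chart_at A p \<in> A" "p \<in> cdom (chart_at A p)"
proof -
  have "p \<in> (\<Union>c\<in>A. cdom c)" using assms by (simp add: smooth_atlas_def)
  then have "\<exists>c. c \<in> A \<and> p \<in> cdom c" by blast
  then have "chart_at A p \<in> A \<and> p \<in> cdom (chart_at A p)"
    unfolding chart_at_def by (rule someI_ex)
  then show "chart_at A p \<in> A" "p \<in> cdom (chart_at A p)" by auto
qed

text \<open>The coordinate expressions of the identity are the transition maps. Hence the chain rule
  for smooth maps below also covers changes of chart.\<close>

lemma smooth_map_id:
  assumes "smooth_atlas X A"
  shows "smooth_map X A X A (\<lambda>p. p)"
  using assms unfolding smooth_map_def smooth_atlas_def transition_def
  by (auto simp: Int_def)

section \<open>Coordinate representatives of maps and their chain rule\<close>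

definition loc_rep :: "'a chart \<Rightarrow> 'b chart \<Rightarrow> ('a \<Rightarrow> 'b) \<Rightarrow> real^3 \<Rightarrow> real^3" where
  "loc_rep c c' f = (\<lambda>x. cmap c' (f (cinv c x)))"

definition loc_dom :: "'a chart \<Rightarrow> 'b chart \<Rightarrow> ('a \<Rightarrow> 'b) \<Rightarrow> (real^3) set" where
  "loc_dom c c' f = cmap c ` {p \<in> cdom c. f p \<in> cdom c'}"

lemma transition_eq_loc_rep: "transition c c' = loc_rep c c' (\<lambda>p. p)"
  by (simp add: transition_def loc_rep_def)

lemma loc_rep_cmap: "is_chart X c \<Longrightarrow> p \<in> cdom c \<Longrightarrow> loc_rep c c' f (cmap c p) = cmap c' (f p)"
  by (simp add: loc_rep_def cinv_cmap)

lemma loc_dom_cmap: "p \<in> cdom c \<Longrightarrow> f p \<in> cdom c' \<Longrightarrow> cmap c p \<in> loc_dom c c' f"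
  by (auto simp: loc_dom_def)

lemma smooth_loc_rep:
  "smooth_map X A Y B f \<Longrightarrow> c \<in> A \<Longrightarrow> c' \<in> B \<Longrightarrow> smooth_on (loc_dom c c' f) (loc_rep c c' f)"
  by (simp add: smooth_map_def loc_rep_def loc_dom_def)

lemma open_loc_dom:
  assumes "is_chart X c" "is_chart Y c'" "continuous_map X Y f"
  shows "open (loc_dom c c' f)"
proof -
  have "openin X {p \<in> topspace X. f p \<in> cdom c'}"
    using assms unfolding is_chart_def continuous_map_def by blast
  from open_cmap_image[OF assms(1) this] have "open (cmap c ` (cdom c \<inter> {p \<in> topspace X. f p \<in> cdom c'}))" .
  moreover have "cdom c \<subseteq> topspace X" using assms(1) unfolding is_chart_def by (simp add: openin_subset)
  then have "cdom c \<inter> {p \<in> topspace X. f p \<in> cdom c'} = {p \<in> cdom c. f p \<in> cdom c'}" by auto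
  ultimately show ?thesis by (simp add: loc_dom_def)
qed

lemma loc_rep_compose:
  assumes A: "smooth_atlas X A" "c \<in> A" "p \<in> cdom c"
    and B: "smooth_atlas Y B" "c' \<in> B" "f p \<in> cdom c'"
    and C: "smooth_atlas Z C" "c'' \<in> C" "g (f p) \<in> cdom c''"
    and f: "smooth_map X A Y B f" and g: "smooth_map Y B Z C g"
  shows "frechet_derivative (loc_rep c c'' (\<lambda>p. g (f p))) (at (cmap c p)) e =
    frechet_derivative (loc_rep c' c'' g) (at (cmap c' (f p)))
      (frechet_derivative (loc_rep c c' f) (at (cmap c p)) e)"
proof (rule fun_cong[OF frechet_derivative_at[symmetric]])
  note ch = smooth_atlas_chart[OF A(1,2)] smooth_atlas_chart[OF B(1,2)] 
  have W: "open (loc_dom c c' f)" "cmap c p \<in> loc_dom c c' f"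
    using open_loc_dom[OF ch] A B f by (simp_all add: smooth_map_def loc_dom_cmap)
  have Df: "(loc_rep c c' f has_derivative frechet_derivative (loc_rep c c' f) (at (cmap c p))) (at (cmap c p))"
    by (rule smooth_on_has_derivative[OF smooth_loc_rep[OF f A(2) B(2)] W(2)])
  have eq: "loc_rep c c' f (cmap c p) = cmap c' (f p)" by (rule loc_rep_cmap[OF ch(1) A(3)])
  have Dg: "(loc_rep c' c'' g has_derivative frechet_derivative (loc_rep c' c'' g) (at (cmap c' (f p))))
      (at (loc_rep c c' f (cmap c p)))"
    unfolding eq
    by (rule smooth_on_has_derivative[OF smooth_loc_rep[OF g B(2) C(2)]]) (simp add: B C loc_dom_cmap)
  show "(loc_rep c c'' (\<lambda>p. g (f p)) has_derivative
      (\<lambda>e. frechet_derivative (loc_rep c' c'' g) (at (cmap c' (f p)))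
        (frechet_derivative (loc_rep c c' f) (at (cmap c p)) e))) (at (cmap c p))"
  \<comment> \<open>The representatives compose where \<open>f\<close> lands in the middle chart
    \<open>c'\<close>; this is an open neighbourhood of the point, which is enough for the
    derivative.\<close>
  proof (rule has_derivative_transform_within_open[OF has_derivative_compose[OF Df Dg] W])
    fix x assume "x \<in> loc_dom c c' f"
    then show "loc_rep c' c'' g (loc_rep c c' f x) = loc_rep c c'' (\<lambda>p. g (f p)) x"
      using cinv_cmap[OF ch(1)] cinv_cmap[OF ch(2)] by (auto simp: loc_dom_def loc_rep_def)
  qed
qed

lemma linear_loc_rep:
  assumes "smooth_map X A Y B f" "c \<in> A" "c' \<in> B" "p \<in> cdom c" "f p \<in> cdom c'"
  shows "linear (frechet_derivative (loc_rep c c' f) (at (cmap c p)))"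
  by (rule has_derivative_linear[OF smooth_on_has_derivative[OF smooth_loc_rep[OF assms(1-3)]]])
    (simp add: assms loc_dom_cmap)

section \<open>Tangent vectors and differentials in charts\<close>

lemma linear_transition:
  assumes "smooth_atlas X A" "c \<in> A" "c' \<in> A" "p \<in> cdom c" "p \<in> cdom c'"
  shows "linear (frechet_derivative (transition c c') (at (cmap c p)))"
  unfolding transition_eq_loc_rep
  by (rule linear_loc_rep[OF smooth_map_id[OF assms(1)]]) (use assms in auto)

lemma tangent_space_transition:
  assumes "v \<in> tangent_space A p" "c \<in> A" "c' \<in> A" "p \<in> cdom c" "p \<in> cdom c'"
  shows "frechet_derivative (transition c c') (at (cmap c p)) (v c) = v c'"
  using assms unfolding tangent_space_def mem_Collect_eq by metis

lemma tangent_space_outside: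
  "v \<in> tangent_space A p \<Longrightarrow> \<not> (c \<in> A \<and> p \<in> cdom c) \<Longrightarrow> v c = 0"
  unfolding tangent_space_def mem_Collect_eq by blast

lemma tangent_vec_eq_coord_vec:
  assumes "v \<in> tangent_space A p" "c \<in> A" "p \<in> cdom c"
  shows "v = coord_vec A c p (v c)"
proof
  show "v c' = coord_vec A c p (v c) c'" for c'
    using tangent_space_transition[OF assms(1,2) _ assms(3)] tangent_space_outside[OF assms(1)]
    by (simp add: coord_vec_def)
qed

text \<open>Compatibility between two charts is the cocycle rule for derivatives of transition maps,
  that is, the chain rule for the identity composed with itself.\<close>

lemma coord_vec_in_tangent_space:
  assumes "smooth_atlas X A" "c \<in> A" "p \<in> cdom c"
  shows "coord_vec A c p e \<in> tangent_space A p"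
proof -
  have "frechet_derivative (transition c1 c2) (at (cmap c1 p)) (frechet_derivative (transition c c1) (at (cmap c p)) e)
      = frechet_derivative (transition c c2) (at (cmap c p)) e"
    if "c1 \<in> A" "c2 \<in> A" "p \<in> cdom c1" "p \<in> cdom c2" for c1 c2
    unfolding transition_eq_loc_rep
    using loc_rep_compose[where f = "\<lambda>p. p" and g = "\<lambda>p. p" and e = e, OF assms assms(1) that(1,3)
        assms(1) that(2,4) smooth_map_id[OF assms(1)] smooth_map_id[OF assms(1)]]
    by simp
  then show ?thesis by (simp add: tangent_space_def coord_vec_def)
qed

lemma coord_vec_add:
  assumes "smooth_atlas X A" "c \<in> A" "p \<in> cdom c"
  shows "coord_vec A c p (e + e') = (\<lambda>c'. coord_vec A c p e c' + coord_vec A c p e' c')"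
  using linear_transition[OF assms(1,2) _ assms(3)] by (auto simp: coord_vec_def linear_add)

lemma coord_vec_scaleR:
  assumes "smooth_atlas X A" "c \<in> A" "p \<in> cdom c"
  shows "coord_vec A c p (r *\<^sub>R e) = (\<lambda>c'. r *\<^sub>R coord_vec A c p e c')"
  using linear_transition[OF assms(1,2) _ assms(3)] by (auto simp: coord_vec_def linear_scale)

lemma tangent_space_add:
  assumes "smooth_atlas X A" "u \<in> tangent_space A p" "v \<in> tangent_space A p"
  shows "(\<lambda>c. u c + v c) \<in> tangent_space A p"
  unfolding tangent_space_def[of A p]
  using linear_transition[OF assms(1), THEN linear_add] assms(2,3)
  by (auto simp: tangent_space_transition tangent_space_outside)

lemma tangent_space_scaleR:
  assumes "smooth_atlas X A" "v \<in> tangent_space A p"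
  shows "(\<lambda>c. r *\<^sub>R v c) \<in> tangent_space A p"
  unfolding tangent_space_def[of A p]
  using linear_transition[OF assms(1), THEN linear_scale] assms(2)
  by (auto simp: tangent_space_transition tangent_space_outside)

text \<open>Frees \<open>differential\<close> from the arbitrary choice in \<open>chart_at\<close>.
  The chain rule is used twice, with the identity before \<open>f\<close> to change the source chart
  and after \<open>f\<close> to change the target chart.\<close>

lemma differential_eq_coord_vec:
  assumes A: "smooth_atlas X A" "c \<in> A" "p \<in> cdom c"
    and B: "smooth_atlas Y B" "c' \<in> B" "f p \<in> cdom c'"
    and f: "smooth_map X A Y B f" and v: "v \<in> tangent_space A p"
  shows "differential A B f p v =
    coord_vec B c' (f p) (frechet_derivative (loc_rep c c' f) (at (cmap c p)) (v c))"
proof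
  fix c''
  let ?c0 = "chart_at A p"
  note c0 = chart_at[OF A(1) smooth_atlas_topspace[OF A]]
  have vc0: "v ?c0 = frechet_derivative (transition c ?c0) (at (cmap c p)) (v c)"
    using tangent_space_transition[OF v A(2) c0(1) A(3) c0(2)] by simp
  show "differential A B f p v c'' =
      coord_vec B c' (f p) (frechet_derivative (loc_rep c c' f) (at (cmap c p)) (v c)) c''"
  proof (cases "c'' \<in> B \<and> f p \<in> cdom c''")
    case True
    then have "differential A B f p v c'' = frechet_derivative (loc_rep ?c0 c'' f) (at (cmap ?c0 p)) (v ?c0)"
      by (simp add: differential_def loc_rep_def Let_def)
    also have "\<dots> = frechet_derivative (loc_rep c c'' f) (at (cmap c p)) (v c)"
      unfolding vc0 transition_eq_loc_rep
      using loc_rep_compose[where f = "\<lambda>p. p" and g = f and e = "v c", OF A A(1) c0 B(1) _ _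
          smooth_map_id[OF A(1)] f, of c''] True
      by simp
    also have "\<dots> = frechet_derivative (transition c' c'') (at (cmap c' (f p)))
        (frechet_derivative (loc_rep c c' f) (at (cmap c p)) (v c))"
      unfolding transition_eq_loc_rep
      using loc_rep_compose[where f = f and g = "\<lambda>p. p" and e = "v c", OF A B B(1) _ _
          f smooth_map_id[OF B(1)], of c''] True
      by simp
    finally show ?thesis using True by (simp add: coord_vec_def)
  qed (auto simp: differential_def coord_vec_def)
qed

lemma smooth_map_topspace: "smooth_map X A Y B f \<Longrightarrow> p \<in> topspace X \<Longrightarrow> f p \<in> topspace Y"
  by (auto simp: smooth_map_def continuous_map_def)

lemma differential_in_tangent_space:
  assumes "smooth_atlas X A" "smooth_atlas Y B" "smooth_map X A Y B f"
    and "p \<in> topspace X" "v \<in> tangent_space A p"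
  shows "differential A B f p v \<in> tangent_space B (f p)"
proof -
  note c = chart_at[OF assms(1,4)] and c' = chart_at[OF assms(2) smooth_map_topspace[OF assms(3,4)]]
  show ?thesis
    unfolding differential_eq_coord_vec[OF assms(1) c assms(2) c' assms(3,5)]
    by (rule coord_vec_in_tangent_space[OF assms(2) c'])
qed

subsection \<open>Pullbacks of forms\<close>

lemma linear_form_rep:
  assumes "smooth_atlas X A" "one_form X A \<omega>" "c \<in> A" "x \<in> cimg c"
  shows "linear (form_rep A \<omega> c x)"
proof -
  have p: "cinv c x \<in> cdom c" "cinv c x \<in> topspace X"
    using assms(4) smooth_atlas_topspace[OF assms(1,3)] by (simp_all add: inv_into_into)
  note T = coord_vec_in_tangent_space[OF assms(1,3) p(1)]
  show ?thesis
    using assms(2) p(2) T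
    by (intro linearI)
      (simp_all add: form_rep_def one_form_def coord_vec_add[OF assms(1,3) p(1)]
        coord_vec_scaleR[OF assms(1,3) p(1)])
qed

lemma form_rep_tangent_vec:
  assumes "smooth_atlas X A" "c \<in> A" "p \<in> cdom c" "v \<in> tangent_space A p"
  shows "form_rep A \<omega> c (cmap c p) (v c) = \<omega> p v"
  using tangent_vec_eq_coord_vec[OF assms(4,2,3)] cinv_cmap[OF smooth_atlas_chart[OF assms(1,2)] assms(3)]
  by (simp add: form_rep_def)

lemma coord_vec_self:
  assumes A: "smooth_atlas X A" "c \<in> A" "p \<in> cdom c"
  shows "coord_vec A c p e c = e"
proof -
  note ch = smooth_atlas_chart[OF A(1,2)]
  have "open (cimg c)" using ch by (simp add: is_chart_def)
  then have "(transition c c has_derivative (\<lambda>e. e)) (at (cmap c p))"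
    by (rule has_derivative_transform_within_open[OF has_derivative_ident])
      (use A cinv_cmap[OF ch] in \<open>auto simp: transition_def\<close>)
  then have "frechet_derivative (transition c c) (at (cmap c p)) = (\<lambda>e. e)"
    by (rule frechet_derivative_at[symmetric])
  then show ?thesis using A by (simp add: coord_vec_def)
qed

lemma loc_dom_loc_rep:
  assumes "is_chart X c" "x \<in> loc_dom c c' f"
  shows "cinv c x \<in> cdom c" "f (cinv c x) \<in> cdom c'" "cmap c (cinv c x) = x"
    "loc_rep c c' f x \<in> cimg c'"
  using assms cinv_cmap[OF assms(1)] by (auto simp: loc_dom_def loc_rep_def)

text \<open>The bridge from forms on the manifold to the coordinate calculus: in charts,
  \<open>pullback\<close> becomes the pullback along \<open>loc_rep c c' f\<close>.\<close>

lemma form_rep_pullback: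
  assumes A: "smooth_atlas X A" "c \<in> A" "c' \<in> A" and f: "smooth_map X A X A f"
    and x: "x \<in> loc_dom c c' f"
  shows "form_rep A (pullback A f \<omega>) c x e =
    form_rep A \<omega> c' (loc_rep c c' f x) (frechet_derivative (loc_rep c c' f) (at x) e)"
proof -
  let ?p = "cinv c x"
  note p = loc_dom_loc_rep[OF smooth_atlas_chart[OF A(1,2)] x]
  have "differential A A f ?p (coord_vec A c ?p e) =
      coord_vec A c' (f ?p) (frechet_derivative (loc_rep c c' f) (at x) e)"
    using differential_eq_coord_vec[OF A(1,2) p(1) A(1,3) p(2) f coord_vec_in_tangent_space[OF A(1,2) p(1)]]
    by (simp add: p(3) coord_vec_self[OF A(1,2) p(1)])
  then show ?thesis
    using cinv_cmap[OF smooth_atlas_chart[OF A(1,3)] p(2)]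
    by (simp add: form_rep_def pullback_def loc_rep_def)
qed

lemma one_form_pullback:
  assumes A: "smooth_atlas X A" and f: "smooth_map X A X A f" and \<omega>: "one_form X A \<omega>"
  shows "one_form X A (pullback A f \<omega>)"
proof -
  have lin: "pullback A f \<omega> p v = form_rep A (pullback A f \<omega>) c (cmap c p) (v c)"
    if "c \<in> A" "p \<in> cdom c" "v \<in> tangent_space A p" for c p v
    using form_rep_tangent_vec[OF A that] by simp
  have smooth: "smooth_on (loc_dom c c' f) (\<lambda>x. form_rep A (pullback A f \<omega>) c x e)"
    and lin': "x \<in> loc_dom c c' f \<Longrightarrow> linear (form_rep A (pullback A f \<omega>) c x)"
    if c: "c \<in> A" "c' \<in> A" for c c' e x
  proof -
    note ch = c[THEN smooth_atlas_chart[OF A]]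
    have W: "open (loc_dom c c' f)"
      using open_loc_dom[OF ch] f by (simp add: smooth_map_def)
    have V: "loc_rep c c' f ` loc_dom c c' f \<subseteq> cimg c'"
      using loc_dom_loc_rep(4)[OF ch(1)] by blast
    have "smooth_on (loc_dom c c' f) (\<lambda>x. form_rep A \<omega> c' (loc_rep c c' f x)
        (frechet_derivative (loc_rep c c' f) (at x) e))"
      by (rule smooth_on_pullback_form[OF W smooth_loc_rep[OF f c] V linear_form_rep[OF A \<omega> c(2)]])
        (use \<omega> c in \<open>auto simp: one_form_def\<close>)
    then show "smooth_on (loc_dom c c' f) (\<lambda>x. form_rep A (pullback A f \<omega>) c x e)"
      using form_rep_pullback[OF A c f] by (simp cong: smooth_on_cong[OF W])
    assume x: "x \<in> loc_dom c c' f"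
    show "linear (form_rep A (pullback A f \<omega>) c x)"
      using linear_compose[OF
          has_derivative_linear[OF smooth_on_has_derivative[OF smooth_loc_rep[OF f c] x]]
          linear_form_rep[OF A \<omega> c(2) loc_dom_loc_rep(4)[OF ch(1) x]]]
      by (simp add: form_rep_pullback[OF A c f x, abs_def] o_def)
  qed
  \<comment> \<open>A fixed target chart describes the pullback only on part of
    \<open>cimg c\<close>. Letting the target chart vary with the point covers all of it, and
    smoothness is local.\<close>
  have cover: "cmap c p \<in> loc_dom c (chart_at A (f p)) f" "chart_at A (f p) \<in> A"
    if "c \<in> A" "p \<in> cdom c" for c p
    using chart_at[OF A smooth_map_topspace[OF f smooth_atlas_topspace[OF A that]]] that
    by (simp_all add: loc_dom_cmap)
  show ?thesis
    unfolding one_form_def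
  proof (intro conjI ballI allI)
    fix p u v assume p: "p \<in> topspace X" and uv: "u \<in> tangent_space A p" "v \<in> tangent_space A p"
    note c = chart_at[OF A p]
    show "pullback A f \<omega> p (\<lambda>c. u c + v c) = pullback A f \<omega> p u + pullback A f \<omega> p v"
      using lin[OF c] uv tangent_space_add[OF A uv]
        linear_add[OF lin'[OF c(1) cover(2)[OF c] cover(1)[OF c]]] by simp
  next
    fix p r v assume p: "p \<in> topspace X" and v: "v \<in> tangent_space A p"
    note c = chart_at[OF A p]
    show "pullback A f \<omega> p (\<lambda>c. r *\<^sub>R v c) = r * pullback A f \<omega> p v"
      using lin[OF c] v tangent_space_scaleR[OF A v]
        linear_scale[OF lin'[OF c(1) cover(2)[OF c] cover(1)[OF c]]] by simp
  next
    fix c e assume c: "c \<in> A"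
    show "smooth_on (cimg c) (\<lambda>x. form_rep A (pullback A f \<omega>) c x e)"
    proof (rule smooth_on_locally)
      fix x assume "x \<in> cimg c"
      then obtain p where p: "p \<in> cdom c" "x = cmap c p" by auto
      let ?c' = "chart_at A (f p)"
      have "open (loc_dom c ?c' f)"
        using open_loc_dom c cover(2)[OF c p(1)] smooth_atlas_chart[OF A] f
        unfolding smooth_map_def by blast
      then show "\<exists>U. open U \<and> x \<in> U \<and> smooth_on U (\<lambda>x. form_rep A (pullback A f \<omega>) c x e)"
        using cover[OF c p(1)] smooth[OF c] p(2) by blast
    qed
  qed
qed

text \<open>The term \<open>da \<and> \<omega>\<close> in \<open>d(a \<omega>) = a d\<omega> + da \<and> \<omega>\<close> is killed by the wedge product with \<open>\<omega>\<close>.\<close>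
lemma wedge_ext_deriv_conformal:
  assumes A: "smooth_atlas X A" and f: "smooth_map X A X A f" and \<omega>: "one_form X A \<omega>"
    and a: "smooth_function A a"
    and eq: "\<And>p v. p \<in> topspace X \<Longrightarrow> v \<in> tangent_space A p \<Longrightarrow> pullback A f \<omega> p v = a p * \<omega> p v"
    and p: "p \<in> topspace X"
    and T: "u \<in> tangent_space A p" "v \<in> tangent_space A p" "w \<in> tangent_space A p"
  shows "wedge \<omega> (ext_deriv A \<omega>) (f p)
      (differential A A f p u) (differential A A f p v) (differential A A f p w) =
    (a p)\<^sup>2 * wedge \<omega> (ext_deriv A \<omega>) p u v w"
proof -
  \<comment> \<open>These are the very charts in which \<open>ext_deriv\<close> is evaluated at p
    and at f p, so representing \<open>f\<close> between them turns both sides directly into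
    coordinate formulas.\<close>
  let ?c = "chart_at A p" and ?c' = "chart_at A (f p)"
  note c = chart_at[OF A p] and c' = chart_at[OF A smooth_map_topspace[OF f p]]
  note ch = smooth_atlas_chart[OF A c(1)] smooth_atlas_chart[OF A c'(1)]
  let ?W = "loc_dom ?c ?c' f" and ?F = "loc_rep ?c ?c' f" and ?x = "cmap ?c p"
  let ?F' = "frechet_derivative ?F (at ?x)"
  have W: "open ?W" "?x \<in> ?W"
    using open_loc_dom[OF ch] f c c' by (simp_all add: smooth_map_def loc_dom_cmap)
  have Fx: "?F ?x = cmap ?c' (f p)" by (rule loc_rep_cmap[OF ch(1) c(2)])
  have x: "?x \<in> cimg ?c" "cinv ?c ?x = p" using c cinv_cmap[OF ch(1)] by auto
  have V: "open (cimg ?c')" "?F ` ?W \<subseteq> cimg ?c'"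
    using ch(2) image_subsetI[OF loc_dom_loc_rep(4)[OF ch(1)]] by (simp_all only: is_chart_def)
  have smooth: "smooth_on (cimg c) (\<lambda>x. form_rep A \<omega> c x e)" if "c \<in> A" for c e
    using \<omega> that by (simp add: one_form_def)
  let ?a' = "frechet_derivative (\<lambda>x. a (cinv ?c x)) (at ?x)"
  have Da: "((\<lambda>x. a (cinv ?c x)) has_derivative ?a') (at ?x)"
    using a c x by (intro smooth_on_has_derivative[of "cimg ?c"]) (auto simp: smooth_function_def)
  \<comment> \<open>The conformal relation is needed on a whole neighbourhood, not only at
    \<open>p\<close>, because it is about to be differentiated.\<close>
  have eq': "form_rep A \<omega> ?c' (?F y) (frechet_derivative ?F (at y) e) = a (cinv ?c y) * form_rep A \<omega> ?c y e"
    if "y \<in> ?W" for y e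
    unfolding form_rep_pullback[OF A c(1) c'(1) f that, symmetric]
    using loc_dom_loc_rep(1)[OF ch(1) that] eq coord_vec_in_tangent_space[OF A c(1)]
      smooth_atlas_topspace[OF A c(1)] by (simp add: form_rep_def)
  have diff: "differential A A f p v ?c' = ?F' (v ?c)" if "v \<in> tangent_space A p" for v
    unfolding differential_eq_coord_vec[OF A c A c' f that] by (rule coord_vec_self[OF A c'])
  have d: "ext_deriv A \<omega> (f p) (differential A A f p u) (differential A A f p v) =
      a p * ext_deriv A \<omega> p u v + (?a' (u ?c) * \<omega> p v - ?a' (v ?c) * \<omega> p u)"
    if "u \<in> tangent_space A p" "v \<in> tangent_space A p" for u v
    using ext_deriv_conformal_pullback[OF W smooth_loc_rep[OF f c(1) c'(1)] V
        linear_form_rep[OF A \<omega> c'(1)] smooth[OF c'(1)]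
        smooth_on_has_derivative[OF smooth[OF c(1)] x(1)] Da eq', of "v ?c" "u ?c"]
    by (simp add: ext_deriv_def Let_def diff that Fx x(2) form_rep_tangent_vec[OF A c])
  have o: "\<omega> (f p) (differential A A f p v) = a p * \<omega> p v" if "v \<in> tangent_space A p" for v
    using eq[OF p that] by (simp add: pullback_def)
  show ?thesis
    unfolding wedge_def d[OF T(1,2)] d[OF T(2,3)] d[OF T(3,1)] T[THEN o]
    by (simp add: algebra_simps power2_eq_square)
qed

subsection \<open>Conformal factors\<close>

text \<open>Each of the three terms of \<omega> \<and> d\<omega> contains a value of \<omega> at p
  as a factor, so \<omega> cannot vanish on the tangent space.\<close>

lemma contact_form_nonzero:
  assumes "contact_form X A \<omega>" "p \<in> topspace X"
  obtains v where "v \<in> tangent_space A p" "\<omega> p v \<noteq> 0"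
proof (rule ccontr)
  assume "\<not> thesis"
  with that have "\<forall>v\<in>tangent_space A p. \<omega> p v = 0" by blast
  moreover obtain u v w where "u \<in> tangent_space A p" "v \<in> tangent_space A p" "w \<in> tangent_space A p"
      "wedge \<omega> (ext_deriv A \<omega>) p u v w \<noteq> 0"
    using assms unfolding contact_form_def by blast
  ultimately show False by (simp add: wedge_def)
qed

lemma one_form_add:
  "one_form X A \<omega> \<Longrightarrow> p \<in> topspace X \<Longrightarrow> u \<in> tangent_space A p \<Longrightarrow> v \<in> tangent_space A p \<Longrightarrow>
    \<omega> p (\<lambda>c. u c + v c) = \<omega> p u + \<omega> p v"
  by (simp add: one_form_def)

lemma one_form_scaleR:
  "one_form X A \<omega> \<Longrightarrow> p \<in> topspace X \<Longrightarrow> v \<in> tangent_space A p \<Longrightarrow>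
    \<omega> p (\<lambda>c. r *\<^sub>R v c) = r * \<omega> p v"
  by (simp add: one_form_def)

lemma one_form_proportional_at:
  assumes A: "smooth_atlas X A" and \<omega>: "one_form X A \<omega>" and \<eta>: "one_form X A \<eta>"
    and p: "p \<in> topspace X" and ker: "ker_form A \<omega> p \<subseteq> ker_form A \<eta> p"
    and T: "v \<in> tangent_space A p" "v0 \<in> tangent_space A p" and v0: "\<omega> p v0 \<noteq> 0"
  shows "\<eta> p v = \<eta> p v0 / \<omega> p v0 * \<omega> p v"
proof -
  \<comment> \<open>The coefficient that moves \<open>v\<close> along \<open>v0\<close> into the
    kernel of \<omega>, and hence into the kernel of \<eta>.\<close>
  let ?r = "- (\<omega> p v / \<omega> p v0)"
  let ?w = "\<lambda>c. v c + ?r *\<^sub>R v0 c"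
  have w: "?w \<in> tangent_space A p"
    by (rule tangent_space_add[OF A T(1) tangent_space_scaleR[OF A T(2)]])
  have lin: "\<theta> p ?w = \<theta> p v + ?r * \<theta> p v0" if "one_form X A \<theta>" for \<theta>
    unfolding one_form_add[OF that p T(1) tangent_space_scaleR[OF A T(2)]] one_form_scaleR[OF that p T(2)] ..
  have "\<omega> p ?w = 0" unfolding lin[OF \<omega>] using v0 by simp
  then have "?w \<in> ker_form A \<omega> p" using w unfolding ker_form_def by blast
  then have "\<eta> p ?w = 0" using ker unfolding ker_form_def by blast
  then show ?thesis unfolding lin[OF \<eta>] by simp
qed

lemma one_form_proportional:
  assumes A: "smooth_atlas X A" and \<omega>: "one_form X A \<omega>" and \<eta>: "one_form X A \<eta>"
    and ker: "\<And>p. p \<in> topspace X \<Longrightarrow> ker_form A \<omega> p \<subseteq> ker_form A \<eta> p"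
    and nz: "\<And>p. p \<in> topspace X \<Longrightarrow> \<exists>v\<in>tangent_space A p. \<omega> p v \<noteq> 0"
  obtains a where "smooth_function A a"
    and "\<And>p v. p \<in> topspace X \<Longrightarrow> v \<in> tangent_space A p \<Longrightarrow> \<eta> p v = a p * \<omega> p v"
proof -
  have "\<forall>p\<in>topspace X. \<exists>r. \<forall>v\<in>tangent_space A p. \<eta> p v = r * \<omega> p v"
    using one_form_proportional_at[OF A \<omega> \<eta> _ ker] nz by blast
  then obtain a where a: "\<And>p v. p \<in> topspace X \<Longrightarrow> v \<in> tangent_space A p \<Longrightarrow> \<eta> p v = a p * \<omega> p v"
    by metis
  have "smooth_function A a"
    unfolding smooth_function_def
  proof (intro ballI smooth_on_locally)
    fix c x assume c: "c \<in> A" and "x \<in> cimg c"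
    then obtain p where p: "p \<in> cdom c" "x = cmap c p" by auto
    note pX = smooth_atlas_topspace[OF A c]
    obtain v where v: "v \<in> tangent_space A p" "\<omega> p v \<noteq> 0" using nz[OF pX[OF p(1)]] by auto
    have smooth: "smooth_on (cimg c) (\<lambda>x. form_rep A \<theta> c x (v c))" if "one_form X A \<theta>" for \<theta>
      using that c by (simp add: one_form_def)
    have op: "open (cimg c)" using smooth_atlas_chart[OF A c] by (simp add: is_chart_def)
    \<comment> \<open>The coordinates \<open>v c\<close> are kept constant while the point moves.
      Where \<omega> stays nonzero on this vector, the factor is forced to be the quotient of two
      smooth functions.\<close>
    let ?U = "cimg c \<inter> (\<lambda>x. form_rep A \<omega> c x (v c)) -` (- {0})"
    have U: "open ?U"
      by (rule continuous_open_preimage[OF smooth_on_imp_continuous_on[OF smooth[OF \<omega>]] op]) (simp add: open_Compl)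
    have xU: "x \<in> ?U" using p v by (simp add: form_rep_tangent_vec[OF A c])
    have "smooth_on ?U (\<lambda>x. form_rep A \<eta> c x (v c) / form_rep A \<omega> c x (v c))"
      by (rule smooth_on_divide[OF U])
        (use smooth_on_subset[OF smooth[OF \<omega>]] smooth_on_subset[OF smooth[OF \<eta>]] in auto)
    moreover have "form_rep A \<eta> c y (v c) / form_rep A \<omega> c y (v c) = a (cinv c y)" if "y \<in> ?U" for y
    proof -
      have "cinv c y \<in> cdom c" using that by (simp add: inv_into_into)
      then show ?thesis
        using that a[OF pX coord_vec_in_tangent_space[OF A c]] by (simp add: form_rep_def)
    qed
    ultimately have "smooth_on ?U (\<lambda>x. a (cinv c x))"
      by (rule smooth_on_cong[OF U, THEN iffD1, rotated])
    then show "\<exists>U. open U \<and> x \<in> U \<and> smooth_on U (\<lambda>x. a (cinv c x))" using U xU by blast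
  qed
  with a show ?thesis using that by blast
qed

lemma smooth_function_cmap_continuous:
  assumes "smooth_function A a" "c \<in> A"
  shows "continuous_on (cimg c) (\<lambda>x. a (cinv c x))"
  using assms smooth_on_imp_continuous_on unfolding smooth_function_def by blast

text \<open>The quotient is continuous with values 1 and -1. Having positive product with its value
  at p is an open condition, and two signs with positive product are equal.\<close>

lemma locally_constant_sign_quotient:
  assumes A: "smooth_atlas X A" and ab: "smooth_function A a" "smooth_function A b"
    and nz: "\<And>p. p \<in> topspace X \<Longrightarrow> a p \<noteq> 0"
    and sq: "\<And>p. p \<in> topspace X \<Longrightarrow> (a p)\<^sup>2 = (b p)\<^sup>2"
  shows "locally_constant X (\<lambda>p. b p / a p)"
proof -
  define q where "q p = b p / a p" for p
  have sign: "q p = 1 \<or> q p = - 1" if "p \<in> topspace X" for p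
    using sq[OF that] nz[OF that] by (auto simp: q_def power2_eq_iff)
  have "\<exists>U. openin X U \<and> p \<in> U \<and> (\<forall>r\<in>U. q r = q p)" if p: "p \<in> topspace X" for p
  proof -
    let ?c = "chart_at A p"
    note c = chart_at[OF A p]
    note ch = smooth_atlas_chart[OF A c(1)] and cX = smooth_atlas_topspace[OF A c(1)]
    have op: "open (cimg ?c)" using ch by (simp add: is_chart_def)
    have "continuous_on (cimg ?c) (\<lambda>x. q (cinv ?c x) * q p)"
      unfolding q_def
      by (intro continuous_on_mult_right continuous_on_divide ab[THEN smooth_function_cmap_continuous, OF c(1)]
          ballI nz cX) (rule inv_into_into)
    then have "open (cimg ?c \<inter> (\<lambda>x. q (cinv ?c x) * q p) -` {0<..})" (is "open ?T")
      by (rule continuous_open_preimage[OF _ op]) simp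
    then have "openin X {q \<in> cdom ?c. cmap ?c q \<in> ?T}" (is "openin X ?U")
      by (rule openin_cmap_vimage[OF ch])
    moreover have "q p * q p > 0" using sign[OF p] by auto
    then have "p \<in> ?U" using c(2) cinv_cmap[OF ch c(2)] by simp
    moreover have "q r = q p" if "r \<in> ?U" for r
    proof -
      have r: "r \<in> cdom ?c" using that by simp
      have "q r * q p > 0" using that cinv_cmap[OF ch r] by simp
      then show ?thesis using sign[OF p] sign[OF cX[OF r]] by (elim disjE) simp_all
    qed
    ultimately show ?thesis by blast
  qed
  then show ?thesis by (simp add: locally_constant_def q_def)
qed

section \<open>Contactomorphisms as conformal maps of the contact form\<close>

text \<open>\<open>push_forward\<close> is indexed by the image point through the inverse of
  \<open>f\<close>; evaluating it at \<open>f p\<close> undoes that inverse and gives a statement at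
  the source point.\<close>

lemma contactomorphism_differential_image:
  assumes "contactomorphism X A D f" "p \<in> topspace X"
  shows "differential A A f p ` D p = D (f p)"
proof -
  have bij: "bij_betw f (topspace X) (topspace X)"
    using assms by (simp add: contactomorphism_def diffeomorphism_def)
  have "f p \<in> topspace X" using bij assms(2) by (rule bij_betwE[THEN bspec])
  then have "push_forward X A f D (f p) = D (f p)"
    using assms(1) by (simp add: contactomorphism_def)
  then show ?thesis
    using bij assms(2) by (simp add: push_forward_def bij_betw_inv_into_left)
qed

text \<open>The differential carries ker \<omega> into ker \<omega>, so ker \<omega> lies in ker
  \<Phi>*\<omega> and the two forms are proportional. The factor may still have zeros at this
  stage.\<close>

lemma contactomorphism_conformal:
  assumes A: "smooth_atlas X A" and \<omega>: "contact_form X A \<omega>"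
    and f: "contactomorphism X A (ker_form A \<omega>) f"
  obtains a where "smooth_function A a"
    and "\<And>p v. p \<in> topspace X \<Longrightarrow> v \<in> tangent_space A p \<Longrightarrow> pullback A f \<omega> p v = a p * \<omega> p v"
proof -
  have \<omega>1: "one_form X A \<omega>" using \<omega> by (simp add: contact_form_def)
  have sm: "smooth_map X A X A f" using f by (simp add: contactomorphism_def diffeomorphism_def)
  show ?thesis
  proof (rule one_form_proportional[OF A \<omega>1 one_form_pullback[OF A sm \<omega>1]])
    fix p assume p: "p \<in> topspace X"
    show "ker_form A \<omega> p \<subseteq> ker_form A (pullback A f \<omega>) p"
      using contactomorphism_differential_image[OF f p] by (auto simp: ker_form_def pullback_def)
    show "\<exists>v\<in>tangent_space A p. \<omega> p v \<noteq> 0" using contact_form_nonzero[OF \<omega> p] by blast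
  qed (rule that)
qed

theorem mainTheorem1:
  fixes X :: "'a topology" and A :: "'a chart set"
    and \<omega>1 \<omega>2 :: "'a form1" and \<epsilon> :: real and \<Phi> :: "'a \<Rightarrow> 'a"
  assumes "smooth_3_manifold X A" and "orientable_manifold X A"
    and "contact_form X A \<omega>1" and "contact_form X A \<omega>2"
    and "bi_contact_structure X A (ker_form A \<omega>1) (ker_form A \<omega>2)"
    and "\<epsilon> \<in> {1, -1}"
    and "\<forall>p\<in>topspace X. \<forall>u\<in>tangent_space A p. \<forall>v\<in>tangent_space A p. \<forall>w\<in>tangent_space A p.
           wedge \<omega>1 (ext_deriv A \<omega>1) p u v w = - \<epsilon> * wedge \<omega>2 (ext_deriv A \<omega>2) p u v w"
    and "bi_contactomorphism X A (ker_form A \<omega>1) (ker_form A \<omega>2) \<Phi>"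
  shows "\<exists>(a :: 'a \<Rightarrow> real) (\<delta> :: 'a \<Rightarrow> real).
           smooth_function A a \<and> (\<forall>p\<in>topspace X. a p \<noteq> 0) \<and>
           locally_constant X \<delta> \<and> (\<forall>p\<in>topspace X. \<delta> p \<in> {1, -1}) \<and>
           (\<forall>p\<in>topspace X. \<forall>v\<in>tangent_space A p.
              pullback A \<Phi> \<omega>1 p v = a p * \<omega>1 p v \<and>
              pullback A \<Phi> \<omega>2 p v = \<delta> p * a p * \<omega>2 p v)"
proof -
  have A: "smooth_atlas X A" using assms(1) by (simp add: smooth_3_manifold_def)
  have \<Phi>: "contactomorphism X A (ker_form A \<omega>1) \<Phi>" "contactomorphism X A (ker_form A \<omega>2) \<Phi>"
    using assms(8) by (simp_all add: bi_contactomorphism_def)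
  have sm: "smooth_map X A X A \<Phi>"
    using \<Phi>(1) by (simp add: contactomorphism_def diffeomorphism_def)
  have of1: "one_form X A \<omega>1" "one_form X A \<omega>2"
    using assms(3,4) by (simp_all add: contact_form_def)
  obtain a where a: "smooth_function A a"
    "\<And>p v. p \<in> topspace X \<Longrightarrow> v \<in> tangent_space A p \<Longrightarrow> pullback A \<Phi> \<omega>1 p v = a p * \<omega>1 p v"
    using contactomorphism_conformal[OF A assms(3) \<Phi>(1)] by blast
  obtain b where b: "smooth_function A b"
    "\<And>p v. p \<in> topspace X \<Longrightarrow> v \<in> tangent_space A p \<Longrightarrow> pullback A \<Phi> \<omega>2 p v = b p * \<omega>2 p v"
    using contactomorphism_conformal[OF A assms(4) \<Phi>(2)] by blast
  have sq: "(a p)\<^sup>2 = (b p)\<^sup>2" if p: "p \<in> topspace X" for p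
  proof -
    \<comment> \<open>A triple on which the volume form is nonzero, so that it can be cancelled at
      the end.\<close>
    obtain u v w where T: "u \<in> tangent_space A p" "v \<in> tangent_space A p" "w \<in> tangent_space A p"
      and nz: "wedge \<omega>1 (ext_deriv A \<omega>1) p u v w \<noteq> 0"
      using assms(3) p unfolding contact_form_def by blast
    let ?d = "differential A A \<Phi> p"
    have "(a p)\<^sup>2 * wedge \<omega>1 (ext_deriv A \<omega>1) p u v w
        = wedge \<omega>1 (ext_deriv A \<omega>1) (\<Phi> p) (?d u) (?d v) (?d w)"
      by (rule wedge_ext_deriv_conformal[OF A sm of1(1) a p T, symmetric])
    \<comment> \<open>The normalization is used twice, here at the image point and below at
      \<open>p\<close>. Since \<epsilon> is the same constant at both, it is absorbed again on
      returning to \<open>p\<close>.\<close>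
    also have "\<dots> = - \<epsilon> * wedge \<omega>2 (ext_deriv A \<omega>2) (\<Phi> p) (?d u) (?d v) (?d w)"
      using assms(7) smooth_map_topspace[OF sm p] T[THEN differential_in_tangent_space[OF A A sm p]]
      by blast
    also have "wedge \<omega>2 (ext_deriv A \<omega>2) (\<Phi> p) (?d u) (?d v) (?d w)
        = (b p)\<^sup>2 * wedge \<omega>2 (ext_deriv A \<omega>2) p u v w"
      by (rule wedge_ext_deriv_conformal[OF A sm of1(2) b p T])
    also have "- \<epsilon> * \<dots> = (b p)\<^sup>2 * (- \<epsilon> * wedge \<omega>2 (ext_deriv A \<omega>2) p u v w)"
      by (simp only: mult_ac)
    also have "- \<epsilon> * wedge \<omega>2 (ext_deriv A \<omega>2) p u v w = wedge \<omega>1 (ext_deriv A \<omega>1) p u v w"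
      using assms(7) p T by simp
    finally show ?thesis using nz by simp
  qed
  have nz: "a p \<noteq> 0" if p: "p \<in> topspace X" for p
  proof
    \<comment> \<open>Otherwise \<open>b p = 0\<close> as well, so both contact planes at \<open>\<Phi> p\<close>, being images under
      the differential, would lie in each other.\<close>
    assume "a p = 0"
    then have 0: "a p = 0" "b p = 0" using sq[OF p] by simp_all
    have "differential A A \<Phi> p v \<in> ker_form A \<omega>1 (\<Phi> p) \<inter> ker_form A \<omega>2 (\<Phi> p)"
      if "v \<in> tangent_space A p" for v
      using a(2)[OF p that] b(2)[OF p that] 0 differential_in_tangent_space[OF A A sm p that]
      by (simp add: pullback_def ker_form_def)
    then have "differential A A \<Phi> p ` ker_form A \<omega> p \<subseteq> ker_form A \<omega>1 (\<Phi> p) \<inter> ker_form A \<omega>2 (\<Phi> p)"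
      for \<omega> unfolding ker_form_def[of A \<omega>] by blast
    from this[of \<omega>1] this[of \<omega>2] have "ker_form A \<omega>1 (\<Phi> p) = ker_form A \<omega>2 (\<Phi> p)"
      unfolding \<Phi>[THEN contactomorphism_differential_image, OF p] by blast
    then show False
      using assms(5) smooth_map_topspace[OF sm p] by (simp add: bi_contact_structure_def)
  qed
  have "locally_constant X (\<lambda>p. b p / a p)"
    by (rule locally_constant_sign_quotient[OF A a(1) b(1) nz sq])
  moreover have "\<forall>p\<in>topspace X. b p / a p \<in> {1, -1}"
  proof
    show "b p / a p \<in> {1, -1}" if "p \<in> topspace X" for p
      using sq[OF that] nz[OF that] by (auto simp: power2_eq_iff)
  qed
  ultimately show ?thesis
    \<comment> \<open>With \<delta> = b/a the product \<delta> a is b, the factor already found for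
      the second form.\<close>
    using a b nz by (intro exI[of _ a] exI[of _ "\<lambda>p. b p / a p"]) simp
qed

end
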